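(* For every positive integer $N$ and every nonempty index $\boldsymbol{k}$, $F_N(\boldsymbol{k};t)=G_N(\boldsymbol{k}^\vee;t)$ in $\mathbb{Q}(t)$.
   Context: $t$ is an indeterminate, $[n]=\{1,\dots,n\}$, $(a)_n=a(a+1)\cdots(a+n-1)$, $\binom{t}{n}=t(t-1)\cdots(t-n+1)/n!$. An index is a tuple of positive integers. $F_N$: for $\boldsymbol{k}=(k_1,\dots,k_r)$ and $A\subset[r]$, $\overline{S}_{r,N}(A)=\{(n_1,\dots,n_r)\in[N-1]^r: n_{i-1}\le n_i\text{ if }1<i\in[r]\setminus A,\ n_{i-1}<n_i\text{ if }1<i\in A\}$ and $F_N(\boldsymbol{k};t)=\sum_{A\subset[r]}(-1)^{\#A}\sum_{\overline{S}_{r,N}(A)}\prod_{i\in A}(N-n_i+t)^{-k_i}\prod_{i\in[r]\setminus A}n_i^{-k_i}$. $G_N$: with $[r]^1_{\boldsymbol{k}}=\{i:k_i=1\}$ and $S^\star_{r,N}(A)$ the set of $(n_1,\dots,n_r)\in[N-1]^r$ such that for each $i\in[r-1]$: $n_i\le n_{i+1}$ if $i\in A$ or $i+1\notin A$, and $n_i<n_{i+1}$ if $i\notin A$ and $i+1\in A$, $G_N(\boldsymbol{k};t)=\sum_{A\subset[r]^1_{\boldsymbol{k}}\setminus\{r\}}\sum_{S^\star_{r,N}(A)}\prod_{i\in A}(N-n_i+t)^{-1}\prod_{i\in[r]\setminus A}n_i^{-k_i}\cdot(-1)^{n_r-1}\binom{t}{n_r}\frac{(1-N)_{n_r}}{(1-N-t)_{n_r}}$.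 Hoffman dual: an index $\boldsymbol{k}$ of weight $w$ is uniquely written as $(1\,\square_1\,1\,\square_2\cdots\square_{w-1}\,1)$ with each $\square_j$ a comma or a plus sign (read as addition); $\boldsymbol{k}^\vee$ is the index obtained by interchanging commas and plus signs in every box. *)

theory Defs
  imports Main "HOL-Computational_Algebra.Polynomial" "HOL-Computational_Algebra.Fraction_Field"
begin

type_synonym ratfun = "rat poly fract"

definition tvar :: ratfun where
  "tvar = Fract [:0, 1:] 1"

definition binomT :: "ratfun \<Rightarrow> nat \<Rightarrow> ratfun" where
  "binomT x n = (\<Prod>j<n. x - of_nat j) / of_nat (fact n)"

text \<open>Indices are lists of positive integers; entry i (1-based) of k is k!(i-1).\<close>
definition is_index :: "nat list \<Rightarrow> bool" where
  "is_index k \<longleftrightarrow> (\<forall>x\<in>set k. 0 < x)"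

text \<open>Hoffman dual. The positions (in [w-1]) of the commas of k written as
  (1 box_1 1 ... box_{w-1} 1) are the proper partial sums k_1+...+k_i, 1 <= i < r.\<close>
definition comma_pos :: "nat list \<Rightarrow> nat set" where
  "comma_pos k = {sum_list (take i k) | i. 1 \<le> i \<and> i < length k}"

definition index_of_commas :: "nat \<Rightarrow> nat set \<Rightarrow> nat list" where
  "index_of_commas w S =
     (let L = sorted_list_of_set (S \<union> {0, w}) in map (\<lambda>i. L ! (i+1) - L ! i) [0..<length L - 1])"

definition hoffman_dual :: "nat list \<Rightarrow> nat list" where
  "hoffman_dual k = index_of_commas (sum_list k) ({1..<sum_list k} - comma_pos k)"

definition Sbar :: "nat \<Rightarrow> nat \<Rightarrow> nat set \<Rightarrow> nat list set" where
  "Sbar r N A = {ns. length ns = r \<and> (\<forall>i\<in>{1..r}. 1 \<le> ns!(i-1) \<and> ns!(i-1) \<le> N - 1) \<and>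
     (\<forall>i\<in>{2..r}. (i \<notin> A \<longrightarrow> ns!(i-2) \<le> ns!(i-1)) \<and> (i \<in> A \<longrightarrow> ns!(i-2) < ns!(i-1)))}"

definition F_N :: "nat \<Rightarrow> nat list \<Rightarrow> ratfun" where
  "F_N N k = (let r = length k in
     \<Sum>A\<in>Pow {1..r}. (-1) ^ card A *
       (\<Sum>ns\<in>Sbar r N A.
          (\<Prod>i\<in>A. inverse (of_nat N - of_nat (ns!(i-1)) + tvar) ^ (k!(i-1))) *
          (\<Prod>i\<in>{1..r} - A. inverse (of_nat (ns!(i-1))) ^ (k!(i-1)))))"

definition Sstar :: "nat \<Rightarrow> nat \<Rightarrow> nat set \<Rightarrow> nat list set" where
  "Sstar r N A = {ns. length ns = r \<and> (\<forall>i\<in>{1..r}. 1 \<le> ns!(i-1) \<and> ns!(i-1) \<le> N - 1) \<and>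
     (\<forall>i\<in>{1..<r}. ((i \<in> A \<or> i+1 \<notin> A) \<longrightarrow> ns!(i-1) \<le> ns!i) \<and>
                   ((i \<notin> A \<and> i+1 \<in> A) \<longrightarrow> ns!(i-1) < ns!i))}"

definition G_N :: "nat \<Rightarrow> nat list \<Rightarrow> ratfun" where
  "G_N N k = (let r = length k in
     \<Sum>A\<in>Pow ({i\<in>{1..r}. k!(i-1) = 1} - {r}).
       (\<Sum>ns\<in>Sstar r N A.
          (\<Prod>i\<in>A. inverse (of_nat N - of_nat (ns!(i-1)) + tvar)) *
          (\<Prod>i\<in>{1..r} - A. inverse (of_nat (ns!(i-1))) ^ (k!(i-1))) *
          ((-1) ^ (ns!(r-1) - 1) * binomT tvar (ns!(r-1)) *
           pochhammer (1 - of_nat N) (ns!(r-1)) / pochhammer (1 - of_nat N - tvar) (ns!(r-1)))))"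

end

theory Submission
  imports Defs
begin

text \<open>Put \<open>T = N + t\<close>. With \<open>T\<close> fixed, neither family of summands involves \<open>N\<close>, apart from the
  last factor \<open>c (N, n)\<close> of \<open>G_N\<close>. Let \<open>s (n)\<close> be the sum defining \<open>F\<close> with all variables at
  most \<open>n\<close>, split its increment as \<open>u (n) + v (n)\<close> according to whether the last position
  lies outside or inside \<open>A\<close>, and let \<open>p (m)\<close>, \<open>q (m)\<close> be the analogous sums for \<open>G\<close> of the dual
  index with last variable \<open>m\<close>. There is a kernel \<open>e (n, m)\<close> with
  \<open>u (n) = \<Sum>m. e (n, m) ((T - n - m) / (T - m) p (m) + q (m))\<close> and
  \<open>v (n) = - \<Sum>m. e (n, m) ((n - m) / (T - m) p (m) + q (m))\<close>.
  This holds for the index (1) and survives both ways of growing an index on the right: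
  adding 1 to the last entry of \<open>k\<close> appends an entry 1 to the dual (the relation is kept
  by Abel summation, since \<open>e (n, m) - e (n, m + 1) = e (n, m) n (T - n) / (m (T - m))\<close>), and
  appending 1 to \<open>k\<close> adds 1 to the last entry of the dual. Adding the two relations and
  summing over \<open>n < N\<close> telescopes to \<open>s (N - 1) = \<Sum>m. c (N, m) p (m)\<close>, which is the theorem.\<close>

section \<open>The field of rational functions\<close>

text \<open>Equality of \<open>a / 1\<close> and \<open>b / 1\<close> forces \<open>a = b\<close> in
  the base domain. Characteristic zero permits the divisions by \<open>j\<close> and
  \<open>fact j\<close> further down.\<close>

instance fract :: ("{idom, ring_char_0}") ring_char_0
proof
  show "inj (of_nat :: nat \<Rightarrow> 'a fract)"
    by (rule injI) (simp add: of_nat_fract eq_fract)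
qed

instance fract :: ("{idom, ring_char_0}") field_char_0 ..

text \<open>The coefficients of degree 1 are 1 and 0. With \<open>a = N\<close> this keeps every
  denominator \<open>T - n\<close> away from zero.\<close>

lemma tvar_add_of_nat_ne: "of_nat a + tvar \<noteq> of_nat b"
proof
  assume "of_nat a + tvar = of_nat b"
  then have "[:0, 1:] + of_nat a = (of_nat b :: rat poly)"
    by (simp add: of_nat_fract tvar_def eq_fract add.commute)
  then have "coeff ([:0, 1:] + of_nat a) 1 = coeff (of_nat b :: rat poly) 1" by simp
  then show False by (simp add: of_nat_poly)
qed

section \<open>The Hoffman dual under growth of the index\<close>

lemma sorted_list_of_set_insert_greater:
  assumes "finite S" "\<And>x. x \<in> S \<Longrightarrow> x < (w::nat)"
  shows "sorted_list_of_set (insert w S) = sorted_list_of_set S @ [w]"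
proof (rule sorted_distinct_set_unique)
  show "sorted (sorted_list_of_set S @ [w])"
    using assms by (auto simp: sorted_append less_imp_le)
  show "distinct (sorted_list_of_set S @ [w])"
    using assms by auto
  show "set (sorted_list_of_set (insert w S)) = set (sorted_list_of_set S @ [w])"
    using assms by (simp del: sorted_list_of_set_insert_remove)
qed (rule sorted_sorted_list_of_set distinct_sorted_list_of_set)+

fun incr_last :: "nat list \<Rightarrow> nat list" where
  "incr_last [] = []"
| "incr_last [x] = [Suc x]"
| "incr_last (x # y # xs) = x # incr_last (y # xs)"

lemma incr_last_snoc [simp]: "incr_last (xs @ [x]) = xs @ [Suc x]"
  by (induction xs rule: incr_last.induct) auto

text \<open>All elements of \<open>insert 0 S\<close> lie below \<open>w\<close>, so the three
  boundary lists share one initial part \<open>L\<close> and differ only in what follows it.\<close>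

lemma sorted_commas_cases:
  assumes "S \<subseteq> {1..<w}" "1 \<le> w"
  obtains L where "L \<noteq> []" "last L < w" "sorted_list_of_set (S \<union> {0, w}) = L @ [w]"
    "sorted_list_of_set (S \<union> {0, Suc w}) = L @ [Suc w]"
    "sorted_list_of_set (insert w S \<union> {0, Suc w}) = L @ [w, Suc w]"
proof
  let ?L = "sorted_list_of_set (insert 0 S)"
  have fin: "finite S" using assms finite_subset by blast
  have lt: "x < w" if "x \<in> insert 0 S" for x using that assms by auto
  show ne: "?L \<noteq> []" using fin by (simp add: sorted_list_of_set_eq_Nil_iff)
  show "last ?L < w" using lt last_in_set[OF ne] fin
    by (simp del: sorted_list_of_set_insert_remove)
  have 1: "S \<union> {0, w} = insert w (insert 0 S)" "S \<union> {0, Suc w} = insert (Suc w) (insert 0 S)"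
    "insert w S \<union> {0, Suc w} = insert (Suc w) (insert w (insert 0 S))" by auto
  show "sorted_list_of_set (S \<union> {0, w}) = ?L @ [w]"
    unfolding 1 by (rule sorted_list_of_set_insert_greater) (use fin lt in auto)
  show "sorted_list_of_set (S \<union> {0, Suc w}) = ?L @ [Suc w]"
    unfolding 1 by (rule sorted_list_of_set_insert_greater) (use fin lt in \<open>auto intro: less_SucI\<close>)
  have "sorted_list_of_set (insert (Suc w) (insert w (insert 0 S))) =
      sorted_list_of_set (insert w (insert 0 S)) @ [Suc w]"
    by (rule sorted_list_of_set_insert_greater) (use fin lt in \<open>auto intro: less_SucI\<close>)
  also have "sorted_list_of_set (insert w (insert 0 S)) = ?L @ [w]"
    by (rule sorted_list_of_set_insert_greater) (use fin lt in auto)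
  finally show "sorted_list_of_set (insert w S \<union> {0, Suc w}) = ?L @ [w, Suc w]"
    unfolding 1 by simp
qed

definition differences :: "nat list \<Rightarrow> nat list" where
  "differences L = map (\<lambda>i. L ! (i+1) - L ! i) [0..<length L - 1]"

lemma differences_snoc:
  assumes "L \<noteq> []"
  shows "differences (L @ [w]) = differences L @ [w - last L]"
proof -
  obtain K y where L: "L = K @ [y]" using assms by (metis rev_exhaust)
  show ?thesis by (auto simp: differences_def L nth_append)
qed

text \<open>Raising the weight from \<open>w\<close> to \<open>Suc w\<close> creates one new box, at
  position \<open>w\<close>. A comma there splits off a final entry 1; a plus there enlarges the
  last entry.\<close>

lemma
  assumes "S \<subseteq> {1..<w}" "1 \<le> w"
  shows index_of_commas_insert: "index_of_commas (Suc w) (insert w S) = index_of_commas w S @ [1]"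
    and index_of_commas_Suc: "index_of_commas (Suc w) S = incr_last (index_of_commas w S)"
    and index_of_commas_ne: "index_of_commas w S \<noteq> []"
proof -
  obtain L where L: "L \<noteq> []" "last L < w" "sorted_list_of_set (S \<union> {0, w}) = L @ [w]"
    "sorted_list_of_set (S \<union> {0, Suc w}) = L @ [Suc w]"
    "sorted_list_of_set (insert w S \<union> {0, Suc w}) = L @ [w, Suc w]"
    using sorted_commas_cases[OF assms] by blast
  have d: "index_of_commas v U = differences (sorted_list_of_set (U \<union> {0, v}))" for v U
    by (simp add: index_of_commas_def differences_def Let_def)
  have 0: "differences (L @ [w, Suc w]) = differences (L @ [w]) @ [1]"
    using differences_snoc[of "L @ [w]" "Suc w"] by simp
  show "index_of_commas (Suc w) (insert w S) = index_of_commas w S @ [1]"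
    unfolding d L 0 ..
  show "index_of_commas (Suc w) S = incr_last (index_of_commas w S)"
    unfolding d L differences_snoc[OF L(1)] using L(2) by (simp add: Suc_diff_le)
  show "index_of_commas w S \<noteq> []"
    unfolding d L differences_snoc[OF L(1)] by simp
qed

lemma comma_pos_snoc_eq: "comma_pos (ks @ [x]) = {sum_list (take i ks) | i. 1 \<le> i \<and> i \<le> length ks}"
  by (auto simp: comma_pos_def) (metis add_0_right diff_is_0_eq less_Suc_eq_le sum_list.Nil take0)+

lemma comma_pos_incr: "comma_pos (ks @ [Suc x]) = comma_pos (ks @ [x])"
  unfolding comma_pos_snoc_eq ..

lemma comma_pos_snoc: "comma_pos (ks @ [x, y]) = insert (sum_list ks + x) (comma_pos (ks @ [x]))"
proof -
  have "comma_pos ((ks @ [x]) @ [y]) = {sum_list (take i (ks @ [x])) | i. 1 \<le> i \<and> i \<le> length ks + 1}"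
    unfolding comma_pos_snoc_eq by simp
  also have "\<dots> = (\<lambda>i. sum_list (take i (ks @ [x]))) ` {1..Suc (length ks)}" by auto
  also have "\<dots> = insert (sum_list ks + x) ((\<lambda>i. sum_list (take i ks)) ` {1..length ks})"
    by (subst atLeastAtMostSuc_conv) auto
  also have "\<dots> = insert (sum_list ks + x) (comma_pos (ks @ [x]))"
    unfolding comma_pos_snoc_eq by auto
  finally show ?thesis by simp
qed

text \<open>Each of these partial sums contains the positive first entry and omits the positive last
  entry \<open>x\<close>.\<close>

lemma comma_pos_bounds:
  assumes "is_index (ks @ [x])"
  shows "comma_pos (ks @ [x]) \<subseteq> {1..<sum_list ks + x}"
proof
  fix p assume "p \<in> comma_pos (ks @ [x])"
  then obtain i where i: "1 \<le> i" "i \<le> length ks" "p = sum_list (take i ks)"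
    by (auto simp: comma_pos_snoc_eq)
  have "sum_list ks = sum_list (take i ks) + sum_list (drop i ks)"
    by (metis append_take_drop_id sum_list_append)
  moreover have "hd ks \<in> set (take i ks)" "hd ks > 0"
    using i assms by (cases ks; cases i; auto simp: is_index_def)+
  then have "sum_list (take i ks) > 0"
    using member_le_sum_list[of "hd ks" "take i ks"] by simp
  ultimately show "p \<in> {1..<sum_list ks + x}"
    using i assms by (auto simp: is_index_def)
qed

text \<open>The old boxes keep their signs. Adding 1 to the last entry makes the new box a plus,
  hence a comma of the dual; appending 1 makes it a comma, hence a plus of the dual.\<close>

lemma
  assumes "is_index (ks @ [x])"
  shows hoffman_dual_incr: "hoffman_dual (ks @ [Suc x]) = hoffman_dual (ks @ [x]) @ [1]"
    and hoffman_dual_snoc: "hoffman_dual (ks @ [x, 1]) = incr_last (hoffman_dual (ks @ [x]))"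
    and hoffman_dual_ne: "hoffman_dual (ks @ [x]) \<noteq> []"
proof -
  define w where "w = sum_list ks + x"
  define S where "S = {1..<w} - comma_pos (ks @ [x])"
  have S: "S \<subseteq> {1..<w}" and w: "1 \<le> w" using assms by (auto simp: S_def w_def is_index_def)
  have c: "comma_pos (ks @ [x]) \<subseteq> {1..<w}" using comma_pos_bounds[OF assms] by (simp add: w_def)
  have h: "hoffman_dual (ks @ [x]) = index_of_commas w S"
    by (simp add: hoffman_dual_def S_def w_def)
  have "{1..<Suc w} - comma_pos (ks @ [Suc x]) = insert w S"
    using c w by (auto simp: S_def comma_pos_incr)
  then show "hoffman_dual (ks @ [Suc x]) = hoffman_dual (ks @ [x]) @ [1]"
    using index_of_commas_insert[OF S w] h by (simp add: hoffman_dual_def w_def)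
  have "{1..<Suc w} - comma_pos (ks @ [x, 1]) = S"
    by (auto simp: S_def comma_pos_snoc w_def)
  then show "hoffman_dual (ks @ [x, 1]) = incr_last (hoffman_dual (ks @ [x]))"
    using index_of_commas_Suc[OF S w] h by (simp add: hoffman_dual_def w_def)
  show "hoffman_dual (ks @ [x]) \<noteq> []" using index_of_commas_ne[OF S w] h by simp
qed

lemma hoffman_dual_one: "hoffman_dual [1] = [1]"
proof -
  have "sorted_list_of_set ({0, Suc 0}) = [0, Suc 0]"
    by (rule sorted_distinct_set_unique) auto
  then show ?thesis by (simp add: hoffman_dual_def index_of_commas_def comma_pos_def)
qed

text \<open>Every nonempty index grows from (1) by these two moves: append a 1, then raise it to the
  required value.\<close>

lemma index_induct [consumes 2, case_names one incr snoc]: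
  assumes "k \<noteq> []" "is_index k"
    and "P [1]"
    and "\<And>ks x. is_index (ks @ [x]) \<Longrightarrow> P (ks @ [x]) \<Longrightarrow> P (ks @ [Suc x])"
    and "\<And>ks x. is_index (ks @ [x]) \<Longrightarrow> P (ks @ [x]) \<Longrightarrow> P (ks @ [x, 1])"
  shows "P k"
  using assms(1,2)
proof (induction k rule: rev_nonempty_induct)
  case (single y)
  then have "0 < y" by (simp add: is_index_def)
  then show ?case
    by (induction y rule: nat_induct_non_zero)
      (use assms(3) assms(4)[of "[]"] in \<open>auto simp: is_index_def\<close>)
next
  case (snoc y ks)
  obtain ls x where ls: "ks = ls @ [x]" using snoc.hyps by (metis rev_exhaust)
  have ix: "is_index ks" "0 < y" using snoc.prems by (auto simp: is_index_def)
  have "P (ks @ [1])" using assms(5)[of ls x] snoc.IH ix ls by simp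
  with ix(2) show ?case
    by (induction y rule: nat_induct_non_zero)
      (use assms(4)[of ks] ix(1) in \<open>auto simp: is_index_def\<close>)
qed

section \<open>The connecting kernel\<close>

text \<open>Factor of a single position, with \<open>b\<close> telling whether it lies in A. The
  global sign of \<open>F_N\<close> is distributed as one minus sign per element of A.\<close>

definition F_weight :: "'a::field \<Rightarrow> nat \<Rightarrow> bool \<Rightarrow> nat \<Rightarrow> 'a" where
  "F_weight T x b n = (if b then - (inverse (T - of_nat n) ^ x) else inverse (of_nat n) ^ x)"

text \<open>The value 0 for \<open>x \<noteq> 1\<close> encodes that A contains only positions with
  entry 1, so that sums may run over all subsets.\<close>

definition G_weight :: "'a::field \<Rightarrow> nat \<Rightarrow> bool \<Rightarrow> nat \<Rightarrow> 'a" where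
  "G_weight T x b n = (if b then if x = 1 then inverse (T - of_nat n) else 0 else inverse (of_nat n) ^ x)"

text \<open>Both states take the index reversed: the head of the list is the last entry. The
  Boolean says whether the last position lies in the subset A, and the natural number is
  the last summation variable.\<close>

fun F_state :: "'a::field \<Rightarrow> nat list \<Rightarrow> bool \<Rightarrow> nat \<Rightarrow> 'a" where
  "F_state T [] b n = 0"
| "F_state T [x] b n = F_weight T x b n"
| "F_state T (x # y # ks) b n =
     F_weight T x b n * (\<Sum>m = 1..(if b then n - 1 else n). F_state T (y # ks) False m + F_state T (y # ks) True m)"

fun G_state :: "'a::field \<Rightarrow> nat list \<Rightarrow> bool \<Rightarrow> nat \<Rightarrow> 'a" where
  "G_state T [] b n = 0"
| "G_state T [x] b n = G_weight T x b n"
| "G_state T (x # y # ks) b n =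
     G_weight T x b n * ((\<Sum>m = 1..(if b then n - 1 else n). G_state T (y # ks) False m) + (\<Sum>m = 1..n. G_state T (y # ks) True m))"

locale non_nat_parameter =
  fixes T :: "'a::field_char_0"
  assumes T_ne_of_nat: "T \<noteq> of_nat n"
begin

text \<open>The connector below is the last factor of \<open>G_N\<close> at the level
  \<open>N = Suc n\<close>, see \<open>connector_closed_form\<close>; the kernel is what remains of it after
  removing the factors that depend on which of the two neighbouring levels \<open>n\<close> and
  \<open>n - 1\<close> is used.\<close>

definition kernel :: "nat \<Rightarrow> nat \<Rightarrow> 'a" where
  "kernel n j = (\<Prod>i = 1..<j. - ((T - of_nat n - of_nat i) * (of_nat n - of_nat i) / (of_nat i * (T - of_nat i))))"

definition connector :: "nat \<Rightarrow> nat \<Rightarrow> 'a" where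
  "connector n j = kernel n j * of_nat n * (T - of_nat n - of_nat j) / (of_nat j * (T - of_nat j))"

lemma T_diff_ne_0 [simp]: "T - of_nat n \<noteq> 0" using T_ne_of_nat[of n] by simp

declare T_ne_of_nat [simp] T_ne_of_nat [symmetric, simp]

lemma T_ne_simps [simp]:
  "T - of_nat n \<noteq> of_nat m" "T \<noteq> 1" "T \<noteq> 1 + of_nat n"
  using T_ne_of_nat[of "n + m"] T_ne_of_nat[of 1] T_ne_of_nat[of "1 + n"] by (auto simp: algebra_simps)

lemma kernel_one [simp]: "kernel n 1 = 1" "kernel n (Suc 0) = 1" by (simp_all add: kernel_def)

lemma kernel_Suc:
  assumes "1 \<le> j"
  shows "kernel n (Suc j) = kernel n j * - ((T - of_nat n - of_nat j) * (of_nat n - of_nat j) / (of_nat j * (T - of_nat j)))"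
  using assms by (simp add: kernel_def)

text \<open>The factor at \<open>i = n\<close> vanishes. Hence sums over \<open>j\<close> may run to
  any common bound \<open>M \<ge> n\<close>, and boundary terms at \<open>Suc M\<close>
  disappear.\<close>

lemma kernel_eq_0:
  assumes "1 \<le> n" "n < j"
  shows "kernel n j = 0"
  using assms by (auto simp: kernel_def intro!: bexI[of _ n])

text \<open>This is the identity \<open>j (T - j) + (T - n - j) (n - j) = n (T - n)\<close>.\<close>

lemma kernel_diff:
  assumes "1 \<le> j"
  shows "kernel n j - kernel n (Suc j) = kernel n j * of_nat n * (T - of_nat n) / (of_nat j * (T - of_nat j))"
  unfolding kernel_Suc[OF assms] using assms by (simp add: divide_simps) algebra

text \<open>At \<open>j = 1\<close> both sides are \<open>m (T - m - 1)\<close>, and passing from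
  \<open>j\<close> to \<open>j + 1\<close> multiplies both by the same factor
  \<open>?r\<close>.\<close>

lemma kernel_shift:
  assumes "1 \<le> j"
  shows "kernel m j * of_nat m * (T - of_nat m - of_nat j) = kernel (Suc m) j * (T - of_nat (Suc m)) * (of_nat (Suc m) - of_nat j)"
  using assms
proof (induction j rule: nat_induct_at_least)
  case (Suc j)
  let ?r = "- ((T - of_nat m - of_nat j - 1) * (of_nat m - of_nat j) / (of_nat j * (T - of_nat j)))"
  have "kernel m (Suc j) * of_nat m * (T - of_nat m - of_nat (Suc j)) = ?r * (kernel m j * of_nat m * (T - of_nat m - of_nat j))"
    unfolding kernel_Suc[OF Suc.hyps] using Suc.hyps by (simp add: divide_simps)
  also have "\<dots> = ?r * (kernel (Suc m) j * (T - of_nat (Suc m)) * (of_nat (Suc m) - of_nat j))"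
    unfolding Suc.IH ..
  also have "\<dots> = kernel (Suc m) (Suc j) * (T - of_nat (Suc m)) * (of_nat (Suc m) - of_nat (Suc j))"
    unfolding kernel_Suc[OF Suc.hyps] using Suc.hyps by (simp add: divide_simps)
  finally show ?case .
qed simp

text \<open>Strict inequality into a position of A produces the level \<open>n - 1\<close>;
  rewriting it through the kernel at level \<open>n\<close> lets both states share one
  kernel.\<close>

lemma connector_pred:
  assumes "1 \<le> n" "1 \<le> j"
  shows "connector (n - 1) j = kernel n j * (T - of_nat n) * (of_nat n - of_nat j) / (of_nat j * (T - of_nat j))"
proof -
  obtain m where "n = Suc m" using assms by (cases n) auto
  then show ?thesis using kernel_shift[OF assms(2), of m] by (simp add: connector_def)
qed

text \<open>The right-hand side is the coefficient of \<open>p (j)\<close> in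
  \<open>u (n) + v (n)\<close>, where the terms in \<open>q (j)\<close> cancel.\<close>

lemma connector_diff:
  assumes "1 \<le> n" "1 \<le> j"
  shows "connector n j - connector (n - 1) j = kernel n j * (T - of_nat n - of_nat j) / (T - of_nat j) - kernel n j * (of_nat n - of_nat j) / (T - of_nat j)"
  unfolding connector_pred[OF assms] unfolding connector_def using assms by (simp add: divide_simps) algebra

lemma kernel_abel_sum:
  assumes "1 \<le> n" "n \<le> M"
  shows "(\<Sum>j = 1..M. kernel n j * of_nat n * (T - of_nat n) / (of_nat j * (T - of_nat j)) * (\<Sum>i = 1..j. f i))
       = (\<Sum>j = 1..M. kernel n j * f j)"
proof -
  have "(\<Sum>j = 1..m. (kernel n j - kernel n (Suc j)) * (\<Sum>i = 1..j. f i))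
       = (\<Sum>j = 1..m. kernel n j * f j) - kernel n (Suc m) * (\<Sum>i = 1..m. f i)" for m
    by (induction m) (simp_all add: algebra_simps)
  from this[of M] show ?thesis
    using assms kernel_eq_0[of n "Suc M"] by (simp add: kernel_diff)
qed

text \<open>By \<open>kernel_diff\<close> the sum telescopes from \<open>kernel n 1 = 1\<close> to
  \<open>kernel n (Suc M) = 0\<close>.\<close>

lemma kernel_sum:
  assumes "1 \<le> n" "n \<le> M"
  shows "(\<Sum>j = 1..M. kernel n j * of_nat n * (T - of_nat n) / (of_nat j * (T - of_nat j))) = 1"
proof -
  have "(\<Sum>j = 1..m. kernel n j - kernel n (Suc j)) = 1 - kernel n (Suc m)" for m
    by (induction m) (simp_all)
  from this[of M] show ?thesis
    using assms kernel_eq_0[of n "Suc M"] by (simp add: kernel_diff)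
qed

text \<open>Here \<open>R / j\<close> and \<open>(R - p) / (T - j)\<close> are the two dual states
  after an entry 1 is appended. The identities follow from
  \<open>(T - n - j) / j + 1 = (T - n) / j\<close> and \<open>(n - j) / j + 1 = n / j\<close>, and
  bring the terms into the shape needed for Abel summation.\<close>

lemma kernel_identities:
  assumes "1 \<le> n" "1 \<le> j"
  shows "kernel n j * ((T - of_nat n - of_nat j) / (T - of_nat j) * (R / of_nat j) + (R - p) / (T - of_nat j))
      = inverse (of_nat n) * (kernel n j * of_nat n * (T - of_nat n) / (of_nat j * (T - of_nat j)) * R) - kernel n j * p / (T - of_nat j)" (is ?A)
    and "kernel n j * ((of_nat n - of_nat j) / (T - of_nat j) * (R / of_nat j) + (R - p) / (T - of_nat j))
      = inverse (T - of_nat n) * (kernel n j * of_nat n * (T - of_nat n) / (of_nat j * (T - of_nat j)) * R) - kernel n j * p / (T - of_nat j)" (is ?B)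
proof -
  \<comment> \<open>Naming the denominator \<open>T - j\<close> as an atom \<open>Y\<close>, with
    \<open>T = Y + J\<close>, leaves a plain identity of fractions.\<close>
  obtain N J Y :: 'a where *: "of_nat n = N" "of_nat j = J" "T - of_nat j = Y" by blast
  have nz: "N \<noteq> 0" "J \<noteq> 0" "Y \<noteq> 0" "T - N \<noteq> 0" using assms T_diff_ne_0[of j] T_diff_ne_0[of n] by (auto simp flip: *)
  have Y: "T = Y + J" using *(2) *(3)[symmetric] by simp
  show ?A using nz(1-3) unfolding * by (simp add: Y field_simps)
  show ?B using nz(2-4) unfolding * by (simp add: divide_simps) (simp add: Y algebra_simps)
qed

section \<open>The relation between an index and its dual, and its behaviour under growth\<close>

text \<open>The relations for \<open>u\<close> and \<open>v\<close>, with both indices reversed. The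
  bound \<open>M\<close> on \<open>j\<close> is the same for all \<open>n\<close>, so that the
  relations can be summed over \<open>n\<close> term by term.\<close>

definition linked :: "nat \<Rightarrow> nat list \<Rightarrow> nat list \<Rightarrow> bool" where
  "linked M k l \<longleftrightarrow> (\<forall>n\<in>{1..M}.
     F_state T k False n = (\<Sum>j = 1..M. kernel n j * ((T - of_nat n - of_nat j) / (T - of_nat j) * G_state T l False j + G_state T l True j)) \<and>
     F_state T k True n = - (\<Sum>j = 1..M. kernel n j * ((of_nat n - of_nat j) / (T - of_nat j) * G_state T l False j + G_state T l True j)))"

lemma linked_one: "linked M [1] [1]"
  unfolding linked_def
proof (intro ballI conjI)
  fix n assume n: "n \<in> {1..M}"
  then have s: "(\<Sum>j = 1..M. kernel n j * of_nat n * (T - of_nat n) / (of_nat j * (T - of_nat j))) = 1"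
    by (intro kernel_sum) auto
  have "(\<Sum>j = 1..M. kernel n j * ((T - of_nat n - of_nat j) / (T - of_nat j) * G_state T [1] False j + G_state T [1] True j))
     = (\<Sum>j = 1..M. inverse (of_nat n) * (kernel n j * of_nat n * (T - of_nat n) / (of_nat j * (T - of_nat j))))"
    \<comment> \<open>The states of (1) are \<open>1 / j\<close> and \<open>1 / (T - j)\<close>,
      which is the case \<open>R = 1\<close>, \<open>p = 0\<close>.\<close>
    using n kernel_identities(1)[of n _ 1 0]
    by (intro sum.cong refl) (simp add: G_weight_def divide_inverse)
  also have "\<dots> = F_state T [1] False n"
    unfolding sum_distrib_left[symmetric] s by (simp add: F_weight_def)
  finally show "F_state T [1] False n = (\<Sum>j = 1..M. kernel n j * ((T - of_nat n - of_nat j) / (T - of_nat j) * G_state T [1] False j + G_state T [1] True j))" ..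
  have "- (\<Sum>j = 1..M. kernel n j * ((of_nat n - of_nat j) / (T - of_nat j) * G_state T [1] False j + G_state T [1] True j))
     = - (\<Sum>j = 1..M. inverse (T - of_nat n) * (kernel n j * of_nat n * (T - of_nat n) / (of_nat j * (T - of_nat j))))"
    using n kernel_identities(2)[of n _ 1 0]
    by (intro sum.cong arg_cong[of _ _ uminus] refl) (simp add: G_weight_def divide_inverse)
  also have "\<dots> = F_state T [1] True n"
    unfolding sum_distrib_left[symmetric] s by (simp add: F_weight_def)
  finally show "F_state T [1] True n = - (\<Sum>j = 1..M. kernel n j * ((of_nat n - of_nat j) / (T - of_nat j) * G_state T [1] False j + G_state T [1] True j))" ..
qed

lemma F_state_Suc:
  "F_state T (Suc x # ks) b n = (if b then inverse (T - of_nat n) else inverse (of_nat n)) * F_state T (x # ks) b n"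
  by (cases ks) (simp_all add: F_weight_def)

text \<open>Positivity of \<open>x\<close> makes the raised entry exceed 1, so its position cannot
  lie in A.\<close>

lemma G_state_Suc:
  assumes "0 < x"
  shows "G_state T (Suc x # ks) b n = (if b then 0 else inverse (of_nat n) * G_state T (x # ks) False n)"
  using assms by (cases ks) (simp_all add: G_weight_def)

text \<open>Abel summation replaces the prefix sums \<open>R\<close> by \<open>p + q\<close>. What
  remains is the old relation multiplied by \<open>1 / n\<close> outside A and by
  \<open>1 / (T - n)\<close> inside, exactly the effect of raising the last entry on the F
  states.\<close>

lemma linked_incr:
  assumes "linked M (x # ks) (y # ls)"
  shows "linked M (Suc x # ks) (1 # y # ls)"
  unfolding linked_def
proof (intro ballI conjI)
  fix n assume n: "n \<in> {1..M}"
  define p where "p = G_state T (y # ls) False"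
  define q where "q = G_state T (y # ls) True"
  define R where "R j = (\<Sum>i = 1..j. p i + q i)" for j
  have P: "G_state T (1 # y # ls) False j = R j / of_nat j" for j
    by (simp add: G_weight_def R_def p_def q_def sum.distrib divide_inverse)
  \<comment> \<open>Entering A from outside is strict, so \<open>p\<close> is summed only to
    \<open>j - 1\<close>, while \<open>q\<close> is summed to \<open>j\<close>.\<close>
  have Q: "G_state T (1 # y # ls) True j = (R j - p j) / (T - of_nat j)" if "1 \<le> j" for j
  proof -
    have "sum p {1..j} = sum p {1..j - 1} + p j" using that by (cases j) auto
    then show ?thesis by (simp add: G_weight_def R_def p_def q_def sum.distrib divide_inverse)
  qed
  have ab: "(\<Sum>j = 1..M. kernel n j * of_nat n * (T - of_nat n) / (of_nat j * (T - of_nat j)) * R j) = (\<Sum>j = 1..M. kernel n j * (p j + q j))"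
    unfolding R_def using n by (intro kernel_abel_sum) auto
  note L = assms[unfolded linked_def, rule_format, OF n, folded p_def q_def]
  note L1 = L[THEN conjunct1] and L2 = L[THEN conjunct2]
  have "(\<Sum>j = 1..M. kernel n j * ((T - of_nat n - of_nat j) / (T - of_nat j) * G_state T (1 # y # ls) False j + G_state T (1 # y # ls) True j))
     = (\<Sum>j = 1..M. inverse (of_nat n) * (kernel n j * of_nat n * (T - of_nat n) / (of_nat j * (T - of_nat j)) * R j) - kernel n j * p j / (T - of_nat j))"
    using n by (intro sum.cong refl) (simp only: P Q kernel_identities(1) atLeastAtMost_iff)
  also have "\<dots> = (\<Sum>j = 1..M. inverse (of_nat n) * (kernel n j * (p j + q j)) - kernel n j * p j / (T - of_nat j))"
    unfolding sum_subtractf sum_distrib_left[symmetric] ab ..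
  also have "\<dots> = inverse (of_nat n) * F_state T (x # ks) False n"
    unfolding L1 sum_distrib_left using n by (intro sum.cong refl) (simp add: divide_simps, algebra)
  finally show "F_state T (Suc x # ks) False n = (\<Sum>j = 1..M. kernel n j * ((T - of_nat n - of_nat j) / (T - of_nat j) * G_state T (1 # y # ls) False j + G_state T (1 # y # ls) True j))"
    by (simp add: F_state_Suc)
  have "- (\<Sum>j = 1..M. kernel n j * ((of_nat n - of_nat j) / (T - of_nat j) * G_state T (1 # y # ls) False j + G_state T (1 # y # ls) True j))
     = - (\<Sum>j = 1..M. inverse (T - of_nat n) * (kernel n j * of_nat n * (T - of_nat n) / (of_nat j * (T - of_nat j)) * R j) - kernel n j * p j / (T - of_nat j))"
    using n by (intro sum.cong arg_cong[of _ _ uminus] refl) (simp only: P Q kernel_identities(2) atLeastAtMost_iff)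
  also have "\<dots> = - (\<Sum>j = 1..M. inverse (T - of_nat n) * (kernel n j * (p j + q j)) - kernel n j * p j / (T - of_nat j))"
    unfolding sum_subtractf sum_distrib_left[symmetric] ab ..
  also have "\<dots> = inverse (T - of_nat n) * F_state T (x # ks) True n"
    unfolding L2 sum_distrib_left mult_minus_right using n by (intro sum.cong arg_cong[of _ _ uminus] refl) (simp add: divide_simps, algebra)
  finally show "F_state T (Suc x # ks) True n = - (\<Sum>j = 1..M. kernel n j * ((of_nat n - of_nat j) / (T - of_nat j) * G_state T (1 # y # ls) False j + G_state T (1 # y # ls) True j))"
    by (simp add: F_state_Suc)
qed

text \<open>Telescoping over the levels by \<open>connector_diff\<close>, starting from
  \<open>connector 0 j = 0\<close>.\<close>

lemma linked_sum:
  assumes "linked M k l" "n \<le> M"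
  shows "(\<Sum>m = 1..n. F_state T k False m + F_state T k True m) = (\<Sum>j = 1..M. connector n j * G_state T l False j)"
  using assms(2)
proof (induction n)
  case 0
  then show ?case by (simp add: connector_def)
next
  case (Suc n)
  have "F_state T k False (Suc n) + F_state T k True (Suc n) = (\<Sum>j = 1..M. (connector (Suc n) j - connector n j) * G_state T l False j)"
  proof -
    have n: "Suc n \<in> {1..M}" using Suc.prems by simp
    note L = assms(1)[unfolded linked_def, rule_format, OF n]
    have D: "connector (Suc n) j - connector n j = kernel (Suc n) j * (T - of_nat (Suc n) - of_nat j) / (T - of_nat j) - kernel (Suc n) j * (of_nat (Suc n) - of_nat j) / (T - of_nat j)"
      if "1 \<le> j" for j using connector_diff[of "Suc n" j] that by simp
    show ?thesis unfolding L[THEN conjunct1] L[THEN conjunct2]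
      by (simp only: diff_conv_add_uminus[symmetric] sum_subtractf[symmetric], rule sum.cong)
        (simp_all add: D algebra_simps)
  qed
  then show ?case using Suc by (simp add: left_diff_distrib sum_subtractf)
qed

text \<open>The raised dual entry exceeds 1, so its state inside A vanishes. Both relations then
  reduce to \<open>linked_sum\<close>, at level \<open>n\<close> outside A and at level
  \<open>n - 1\<close> inside A.\<close>

lemma linked_snoc:
  assumes "linked M (x # ks) (y # ls)" "0 < y"
  shows "linked M (1 # x # ks) (Suc y # ls)"
  unfolding linked_def
proof (intro ballI conjI)
  fix n assume n: "n \<in> {1..M}"
  have "F_state T (1 # x # ks) False n = inverse (of_nat n) * (\<Sum>j = 1..M. connector n j * G_state T (y # ls) False j)"
    using linked_sum[OF assms(1), of n] n by (simp add: F_weight_def)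
  also have "\<dots> = (\<Sum>j = 1..M. kernel n j * ((T - of_nat n - of_nat j) / (T - of_nat j) * G_state T (Suc y # ls) False j + G_state T (Suc y # ls) True j))"
    unfolding sum_distrib_left using n
    by (intro sum.cong refl) (simp add: G_state_Suc assms(2) connector_def divide_simps)
  finally show "F_state T (1 # x # ks) False n = \<dots>" .
  have "F_state T (1 # x # ks) True n = - inverse (T - of_nat n) * (\<Sum>j = 1..M. connector (n - 1) j * G_state T (y # ls) False j)"
    using linked_sum[OF assms(1), of "n - 1"] n by (subst F_state.simps(3)) (simp add: F_weight_def le_diff_conv)
  also have "\<dots> = - (\<Sum>j = 1..M. kernel n j * ((of_nat n - of_nat j) / (T - of_nat j) * G_state T (Suc y # ls) False j + G_state T (Suc y # ls) True j))"
    unfolding sum_distrib_left mult_minus_left sum_negf[symmetric] using n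
    by (intro sum.cong refl, subst connector_pred) (simp_all add: G_state_Suc assms(2) divide_simps)
  finally show "F_state T (1 # x # ks) True n = \<dots>" .
qed

text \<open>For \<open>T = N + t\<close> and \<open>N = Suc M\<close> the product is the numerator
  of the binomial coefficient of \<open>t\<close> over \<open>j\<close>, so this is the last factor
  of \<open>G_N\<close>. Passing to \<open>j + 1\<close> multiplies both sides by
  \<open>(T - N - j) (j - M) / ((j + 1) (T - 1 - j))\<close>.\<close>

lemma connector_closed_form:
  assumes "1 \<le> j"
  shows "connector M j = (-1) ^ (j - 1) * ((\<Prod>i<j. T - of_nat (Suc M) - of_nat i) / of_nat (fact j)) *
     pochhammer (1 - of_nat (Suc M)) j / pochhammer (1 - T) j"
  using assms
proof (induction j rule: nat_induct_at_least)
  case base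
  have "1 - T \<noteq> 0" using T_ne_simps(2) by simp
  moreover have "T - 1 \<noteq> 0" using T_diff_ne_0[of 1] by simp
  ultimately show ?case by (simp add: connector_def divide_simps) algebra
next
  case (Suc j)
  have nz: "1 - T + of_nat j \<noteq> 0" "T - 1 - of_nat j \<noteq> 0" "(1::'a) + of_nat j \<noteq> 0"
    using T_diff_ne_0[of "Suc j"] of_nat_neq_0[of j, where 'a='a]
    by (auto simp: algebra_simps)
  have "connector M (Suc j) = connector M j * ((T - of_nat (Suc M) - of_nat j) * (of_nat j - of_nat M) / (of_nat (Suc j) * (T - 1 - of_nat j)))"
    unfolding connector_def kernel_Suc[OF Suc.hyps] using Suc.hyps nz by (simp add: divide_simps) algebra
  also have "\<dots> = (-1) ^ (Suc j - 1) * ((\<Prod>i<Suc j. T - of_nat (Suc M) - of_nat i) / of_nat (fact (Suc j))) *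
     pochhammer (1 - of_nat (Suc M)) (Suc j) / pochhammer (1 - T) (Suc j)"
  proof -
    \<comment> \<open>The right-hand side has the new Pochhammer factors; the reversed denominator
      supplies the alternating sign.\<close>
    have q: "(of_nat j - of_nat M) / (T - 1 - of_nat j) = - ((1 - of_nat (Suc M) + of_nat j) / (1 - T + of_nat j))"
      using nz by (simp add: divide_simps) algebra
    have s: "(-1 :: 'a) ^ (Suc j - 1) = - ((-1) ^ (j - 1))" using Suc.hyps by (cases j) auto
    have "connector M j * ((T - of_nat (Suc M) - of_nat j) * (of_nat j - of_nat M) / (of_nat (Suc j) * (T - 1 - of_nat j)))
      = connector M j * (T - of_nat (Suc M) - of_nat j) / of_nat (Suc j) * ((of_nat j - of_nat M) / (T - 1 - of_nat j))"
      by simp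
    also have "\<dots> = (-1) ^ (Suc j - 1) * ((\<Prod>i<Suc j. T - of_nat (Suc M) - of_nat i) / of_nat (fact (Suc j))) *
      pochhammer (1 - of_nat (Suc M)) (Suc j) / pochhammer (1 - T) (Suc j)"
      unfolding q Suc.IH pochhammer_Suc fact_Suc prod.lessThan_Suc s of_nat_mult
      by (simp add: mult_ac del: of_nat_Suc of_nat_fact)
    finally show ?thesis .
  qed
  finally show ?case .
qed

end

section \<open>Transfer sums\<close>

lemma sum_Pow_Suc:
  fixes g :: "nat set \<Rightarrow> 'a::comm_monoid_add"
  shows "(\<Sum>A\<in>Pow {1..Suc r}. g A) = (\<Sum>A\<in>Pow {1..r}. g A + g (insert (Suc r) A))"
proof -
  have "inj_on (insert (Suc r)) (Pow {1..r})"
    by (rule inj_onI) (metis Diff_insert_absorb PowD atLeastAtMost_iff not_less_eq_eq order_refl subsetD)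
  moreover have "Pow {1..r} \<inter> insert (Suc r) ` Pow {1..r} = {}" by fastforce
  moreover have "{1..Suc r} = insert (Suc r) {1..r}" by auto
  ultimately show ?thesis
    by (simp add: Pow_insert sum.union_disjoint sum.reindex sum.distrib)
qed

lemma sum_lists_Suc:
  fixes f :: "'b list \<Rightarrow> 'a::comm_monoid_add"
  assumes "finite X"
  shows "(\<Sum>ns | length ns = Suc r \<and> set ns \<subseteq> X. f ns)
       = (\<Sum>ns | length ns = r \<and> set ns \<subseteq> X. \<Sum>n\<in>X. f (ns @ [n]))"
proof -
  have "(\<Sum>ns | length ns = r \<and> set ns \<subseteq> X. \<Sum>n\<in>X. f (ns @ [n]))
      = (\<Sum>z\<in>{ns. length ns = r \<and> set ns \<subseteq> X} \<times> X. f (fst z @ [snd z]))"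
    by (simp add: sum.cartesian_product split_beta)
  also have "\<dots> = (\<Sum>ns | length ns = Suc r \<and> set ns \<subseteq> X. f ns)"
  proof (rule sum.reindex_bij_witness[where j = "\<lambda>z. fst z @ [snd z]" and i = "\<lambda>ns. (butlast ns, last ns)"])
    fix ns assume ns: "ns \<in> {ns. length ns = Suc r \<and> set ns \<subseteq> X}"
    then have "ns \<noteq> []" by auto
    with ns show "(butlast ns, last ns) \<in> {ns. length ns = r \<and> set ns \<subseteq> X} \<times> X"
      by (auto dest: in_set_butlastD)
    show "fst (butlast ns, last ns) @ [snd (butlast ns, last ns)] = ns"
      using \<open>ns \<noteq> []\<close> by simp
  qed auto
  finally show ?thesis ..
qed

text \<open>The transfer-matrix recursion common to both states, last position first. A state is a
  membership bit with a value, and \<open>R a m b n\<close> permits \<open>(b, n)\<close> directly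
  after \<open>(a, m)\<close>.\<close>

fun transfer :: "nat set \<Rightarrow> (bool \<Rightarrow> nat \<Rightarrow> bool \<Rightarrow> nat \<Rightarrow> bool) \<Rightarrow>
    (bool \<Rightarrow> nat \<Rightarrow> 'a::comm_semiring_1) list \<Rightarrow> bool \<Rightarrow> nat \<Rightarrow> 'a" where
  "transfer X R [] b n = 0"
| "transfer X R [w] b n = w b n"
| "transfer X R (w # v # ws) b n =
     w b n * (\<Sum>m\<in>X. of_bool (R False m b n) * transfer X R (v # ws) False m
                    + of_bool (R True m b n) * transfer X R (v # ws) True m)"

text \<open>Induction on the last position. The end factor \<open>h\<close> is arbitrary so that the
  induction hypothesis can absorb the transition into the new last state together with its
  weight.\<close>

lemma sum_transfer:
  fixes h :: "bool \<Rightarrow> nat \<Rightarrow> 'a::comm_ring_1"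
  assumes "finite X" "ws \<noteq> []"
  shows "(\<Sum>A\<in>Pow {1..length ws}. \<Sum>ns | length ns = length ws \<and> set ns \<subseteq> X.
           (\<Prod>i\<in>{1..length ws}. (ws ! (i - 1)) (i \<in> A) (ns ! (i - 1))) *
           (\<Prod>i\<in>{1..<length ws}. of_bool (R (i \<in> A) (ns ! (i - 1)) (i + 1 \<in> A) (ns ! i))) *
           h (length ws \<in> A) (ns ! (length ws - 1)))
       = (\<Sum>n\<in>X. transfer X R (rev ws) False n * h False n + transfer X R (rev ws) True n * h True n)"
  using assms(2)
proof (induction ws arbitrary: h rule: rev_nonempty_induct)
  case (single w)
  have "Pow {Suc 0} = {{}, {Suc 0}}" by auto
  moreover have "{ns. ns = [] \<and> set ns \<subseteq> X} = {[]}" by auto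
  then have "(\<Sum>ns | length ns = Suc 0 \<and> set ns \<subseteq> X. f ns) = (\<Sum>n\<in>X. f [n])" for f :: "nat list \<Rightarrow> 'a"
    using sum_lists_Suc[OF assms(1), of f 0] by simp
  ultimately show ?case by (simp add: sum.distrib)
next
  case (snoc w ws)
  define r where "r = length ws"
  have r: "1 \<le> r" using snoc.hyps by (cases ws) (auto simp: r_def)
  obtain v vs where vs: "rev ws = v # vs" using snoc.hyps by (metis neq_Nil_conv rev_is_Nil_conv)
  define P where "P A ns = (\<Prod>i\<in>{1..r}. (ws ! (i - 1)) (i \<in> A) (ns ! (i - 1))) *
           (\<Prod>i\<in>{1..<r}. of_bool (R (i \<in> A) (ns ! (i - 1)) (i + 1 \<in> A) (ns ! i)) :: 'a)" for A and ns :: "nat list"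
  define Q where "Q b n A ns = P A ns * (of_bool (R (r \<in> A) (ns ! (r - 1)) b n) * w b n * h b n)" for b n A and ns :: "nat list"
  have IH: "(\<Sum>A\<in>Pow {1..r}. \<Sum>ns | length ns = r \<and> set ns \<subseteq> X. Q b n A ns)
     = (\<Sum>m\<in>X. transfer X R (rev ws) False m * (of_bool (R False m b n) * w b n * h b n)
              + transfer X R (rev ws) True m * (of_bool (R True m b n) * w b n * h b n))" for b n
    using snoc.IH[of "\<lambda>b' m. of_bool (R b' m b n) * w b n * h b n"] by (simp add: Q_def P_def r_def)
  have IH': "(\<Sum>A\<in>Pow {1..r}. \<Sum>ns | length ns = r \<and> set ns \<subseteq> X. Q b n A ns)
     = transfer X R (rev (ws @ [w])) b n * h b n" for b n
    unfolding IH by (simp add: vs sum_distrib_left sum_distrib_right algebra_simps)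
  have step: "(\<Prod>i\<in>{1..Suc r}. ((ws @ [w]) ! (i - 1)) (i \<in> A) ((ns @ [n]) ! (i - 1))) *
       (\<Prod>i\<in>{1..<Suc r}. of_bool (R (i \<in> A) ((ns @ [n]) ! (i - 1)) (i + 1 \<in> A) ((ns @ [n]) ! i))) *
       h (Suc r \<in> A) ((ns @ [n]) ! (Suc r - 1)) = Q (Suc r \<in> A) n A ns"
    if "length ns = r" for A n ns
  proof -
    have "(\<Prod>i\<in>{1..Suc r}. ((ws @ [w]) ! (i - 1)) (i \<in> A) ((ns @ [n]) ! (i - 1)))
        = (\<Prod>i\<in>{1..r}. (ws ! (i - 1)) (i \<in> A) (ns ! (i - 1))) * w (Suc r \<in> A) n"
      using that by (simp add: nth_append r_def[symmetric]) (rule arg_cong2[of _ _ _ _ "(*)"], rule prod.cong, auto)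
    moreover have "(\<Prod>i\<in>{1..<Suc r}. of_bool (R (i \<in> A) ((ns @ [n]) ! (i - 1)) (i + 1 \<in> A) ((ns @ [n]) ! i)) :: 'a)
        = (\<Prod>i\<in>{1..<r}. of_bool (R (i \<in> A) (ns ! (i - 1)) (i + 1 \<in> A) (ns ! i))) *
          of_bool (R (r \<in> A) (ns ! (r - 1)) (Suc r \<in> A) n)"
      using that r by (simp add: nth_append prod.atLeastLessThan_Suc) (rule impI, rule prod.cong, auto)
    ultimately show ?thesis using that by (simp add: Q_def P_def mult_ac nth_append)
  qed
  \<comment> \<open>\<open>Q\<close> tests membership in A only at positions up to \<open>r\<close>,
    so the subsets with and without \<open>Suc r\<close> can be paired.\<close>
  have Q_insert: "Q b n (insert (Suc r) A) ns = Q b n A ns" for b n A ns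
  proof -
    have "P (insert (Suc r) A) ns = P A ns"
      unfolding P_def by (intro arg_cong2[of _ _ _ _ "(*)"] prod.cong) auto
    then show ?thesis by (simp add: Q_def)
  qed
  have "(\<Sum>A\<in>Pow {1..Suc r}. \<Sum>ns | length ns = Suc r \<and> set ns \<subseteq> X.
       (\<Prod>i\<in>{1..Suc r}. ((ws @ [w]) ! (i - 1)) (i \<in> A) (ns ! (i - 1))) *
       (\<Prod>i\<in>{1..<Suc r}. of_bool (R (i \<in> A) (ns ! (i - 1)) (i + 1 \<in> A) (ns ! i))) *
       h (Suc r \<in> A) (ns ! (Suc r - 1)))
     = (\<Sum>A\<in>Pow {1..Suc r}. \<Sum>ns | length ns = r \<and> set ns \<subseteq> X. \<Sum>n\<in>X. Q (Suc r \<in> A) n A ns)"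
    unfolding sum_lists_Suc[OF assms(1)] by (intro sum.cong refl) (use step in blast)
  also have "\<dots> = (\<Sum>A\<in>Pow {1..r}. \<Sum>ns | length ns = r \<and> set ns \<subseteq> X. \<Sum>n\<in>X. Q False n A ns + Q True n A ns)"
  proof -
    have "Suc r \<notin> A" if "A \<in> Pow {1..r}" for A using that by auto
    then show ?thesis unfolding sum_Pow_Suc sum.distrib
      by (intro arg_cong2[of _ _ _ _ "(+)"] sum.cong refl) (simp_all only: Q_insert insertI1 simp_thms)
  qed
  also have "\<dots> = (\<Sum>n\<in>X. \<Sum>A\<in>Pow {1..r}. \<Sum>ns | length ns = r \<and> set ns \<subseteq> X. Q False n A ns + Q True n A ns)"
    by (subst sum.swap[where B = X], subst sum.swap[where B = X]) (rule refl)
  also have "\<dots> = (\<Sum>n\<in>X. transfer X R (rev (ws @ [w])) False n * h False n + transfer X R (rev (ws @ [w])) True n * h True n)"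
    by (simp only: sum.distrib IH')
  finally show ?case by (simp only: r_def length_append_singleton)
qed

section \<open>Both sides of the theorem as transfer sums\<close>

lemma sum_of_bool_le:
  fixes f :: "nat \<Rightarrow> 'a::comm_ring_1"
  assumes "n \<le> M"
  shows "(\<Sum>m = 1..M. of_bool (m \<le> n) * f m) = (\<Sum>m = 1..n. f m)"
    and "(\<Sum>m = 1..M. of_bool (m < n) * f m) = (\<Sum>m = 1..n - 1. f m)"
  by (rule sum.mono_neutral_cong_right; use assms in auto)+

definition strict_into :: "bool \<Rightarrow> nat \<Rightarrow> bool \<Rightarrow> nat \<Rightarrow> bool" where
  "strict_into a m b n \<longleftrightarrow> (if b then m < n else m \<le> n)"

definition strict_enter :: "bool \<Rightarrow> nat \<Rightarrow> bool \<Rightarrow> nat \<Rightarrow> bool" where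
  "strict_enter a m b n \<longleftrightarrow> (if \<not> a \<and> b then m < n else m \<le> n)"

lemma transfer_F_state:
  assumes "n \<in> {1..M}"
  shows "transfer {1..M} strict_into (map (F_weight T) ks) b n = F_state (T :: 'a::field_char_0) ks b n"
  using assms
proof (induction ks arbitrary: b n rule: induct_list012)
  case (3 x y ks)
  have "transfer {1..M} strict_into (map (F_weight T) (x # y # ks)) b n =
    F_weight T x b n * (\<Sum>m = 1..M. of_bool (strict_into False m b n) * F_state T (y # ks) False m
                             + of_bool (strict_into True m b n) * F_state T (y # ks) True m)"
    unfolding list.map transfer.simps
    by (intro arg_cong2[of _ _ _ _ "(*)"] sum.cong refl) (simp add: "3.IH"(2)[simplified])
  also have "\<dots> = F_state T (x # y # ks) b n"
    using 3(3) by (cases b) (simp_all only: strict_into_def sum_of_bool_le sum.distrib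
      if_True if_False simp_thms atLeastAtMost_iff F_state.simps)
  finally show ?case .
qed auto

lemma transfer_G_state:
  assumes "n \<in> {1..M}"
  shows "transfer {1..M} strict_enter (map (G_weight T) ks) b n = G_state (T :: 'a::field_char_0) ks b n"
  using assms
proof (induction ks arbitrary: b n rule: induct_list012)
  case (3 x y ks)
  have "transfer {1..M} strict_enter (map (G_weight T) (x # y # ks)) b n =
    G_weight T x b n * (\<Sum>m = 1..M. of_bool (strict_enter False m b n) * G_state T (y # ks) False m
                             + of_bool (strict_enter True m b n) * G_state T (y # ks) True m)"
    unfolding list.map transfer.simps
    by (intro arg_cong2[of _ _ _ _ "(*)"] sum.cong refl) (simp add: "3.IH"(2)[simplified])
  also have "\<dots> = G_state T (x # y # ks) b n"
    using 3(3) by (cases b) (simp_all only: strict_enter_def sum_of_bool_le sum.distrib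
      if_True if_False simp_thms atLeastAtMost_iff G_state.simps)
  finally show ?case .
qed auto

lemma prod_of_bool_Ball: "finite I \<Longrightarrow> (\<Prod>i\<in>I. of_bool (P i)) = (of_bool (\<forall>i\<in>I. P i) :: 'a::comm_semiring_1)"
  by (induction I rule: finite_induct) auto

lemma sum_constrained_lists:
  fixes f :: "nat list \<Rightarrow> 'a::comm_ring_1"
  shows "(\<Sum>ns | length ns = r \<and> (\<forall>i\<in>{1..r}. 1 \<le> ns ! (i - 1) \<and> ns ! (i - 1) \<le> M) \<and> (\<forall>i\<in>{1..<r}. S i ns). f ns)
     = (\<Sum>ns | length ns = r \<and> set ns \<subseteq> {1..M}. (\<Prod>i\<in>{1..<r}. of_bool (S i ns)) * f ns)"
proof -
  have "(\<forall>i\<in>{1..r}. 1 \<le> ns ! (i - 1) \<and> ns ! (i - 1) \<le> M) \<longleftrightarrow> set ns \<subseteq> {1..M}" if "length ns = r" for ns :: "nat list"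
  proof -
    have "(\<forall>i\<in>{1..r}. Q (i - 1)) \<longleftrightarrow> (\<forall>i<r. Q i)" for Q
      by (auto, metis Suc_le_eq Suc_le_mono Suc_pred diff_Suc_1 le0 less_Suc_eq_le One_nat_def atLeastAtMost_iff)
    from this[of "\<lambda>i. 1 \<le> ns ! i \<and> ns ! i \<le> M"] show ?thesis using that
      by (simp only: subset_iff in_set_conv_nth atLeastAtMost_iff) blast
  qed
  then have "{ns. length ns = r \<and> (\<forall>i\<in>{1..r}. 1 \<le> ns ! (i - 1) \<and> ns ! (i - 1) \<le> M) \<and> (\<forall>i\<in>{1..<r}. S i ns)}
      = {ns \<in> {ns. length ns = r \<and> set ns \<subseteq> {1..M}}. \<forall>i\<in>{1..<r}. S i ns}" by blast
  moreover have "finite {ns. length ns = r \<and> set ns \<subseteq> {1..M}}"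
    using finite_lists_length_eq[of "{1..M}" r] by (simp add: conj_commute)
  ultimately show ?thesis
    by (simp add: sum.inter_filter prod_of_bool_Ball) (rule sum.cong, auto)
qed

lemma sum_Sbar:
  "(\<Sum>ns\<in>Sbar r N A. f ns) = (\<Sum>ns | length ns = r \<and> set ns \<subseteq> {1..N - 1}.
     (\<Prod>i\<in>{1..<r}. of_bool (strict_into (i \<in> A) (ns ! (i - 1)) (i + 1 \<in> A) (ns ! i))) * (f ns :: 'a::comm_ring_1))"
proof -
  \<comment> \<open>\<open>Sbar\<close> indexes a neighbouring pair by its later position, the
    transfer sum by its earlier one.\<close>
  have "(\<forall>i\<in>{2..r}. Q (i - 2) (i - 1) i) \<longleftrightarrow> (\<forall>i\<in>{1..<r}. Q (i - 1) i (i + 1))" for Q :: "nat \<Rightarrow> nat \<Rightarrow> nat \<Rightarrow> bool"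
  proof (intro iffI ballI)
    fix i assume "\<forall>i\<in>{2..r}. Q (i - 2) (i - 1) i" "i \<in> {1..<r}"
    then show "Q (i - 1) i (i + 1)" by (auto dest!: bspec[of _ _ "i + 1"])
  next
    fix i assume *: "\<forall>i\<in>{1..<r}. Q (i - 1) i (i + 1)" "i \<in> {2..r}"
    then have "Q (i - 1 - 1) (i - 1) (i - 1 + 1)" by (intro bspec[OF *(1)]) auto
    with *(2) show "Q (i - 2) (i - 1) i" by (simp add: numeral_2_eq_2)
  qed
  from this[of "\<lambda>a b i. (i \<notin> A \<longrightarrow> ns ! a \<le> ns ! b) \<and> (i \<in> A \<longrightarrow> ns ! a < ns ! b)" for ns :: "nat list"]
  have "Sbar r N A = {ns. length ns = r \<and> (\<forall>i\<in>{1..r}. 1 \<le> ns ! (i - 1) \<and> ns ! (i - 1) \<le> N - 1) \<and>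
      (\<forall>i\<in>{1..<r}. strict_into (i \<in> A) (ns ! (i - 1)) (i + 1 \<in> A) (ns ! i))}"
    unfolding Sbar_def strict_into_def by (intro Collect_cong conj_cong refl) (simp add: if_bool_eq_conj conj_commute)
  then show ?thesis by (simp only: sum_constrained_lists)
qed

lemma sum_Sstar:
  "(\<Sum>ns\<in>Sstar r N A. f ns) = (\<Sum>ns | length ns = r \<and> set ns \<subseteq> {1..N - 1}.
     (\<Prod>i\<in>{1..<r}. of_bool (strict_enter (i \<in> A) (ns ! (i - 1)) (i + 1 \<in> A) (ns ! i))) * (f ns :: 'a::comm_ring_1))"
proof -
  have "Sstar r N A = {ns. length ns = r \<and> (\<forall>i\<in>{1..r}. 1 \<le> ns ! (i - 1) \<and> ns ! (i - 1) \<le> N - 1) \<and>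
      (\<forall>i\<in>{1..<r}. strict_enter (i \<in> A) (ns ! (i - 1)) (i + 1 \<in> A) (ns ! i))}"
    unfolding Sstar_def strict_enter_def by (intro Collect_cong conj_cong ball_cong refl) auto
  then show ?thesis by (simp only: sum_constrained_lists)
qed

lemma prod_split_subset:
  fixes f g :: "nat \<Rightarrow> 'a::comm_monoid_mult"
  assumes "finite I" "A \<subseteq> I"
  shows "(\<Prod>i\<in>I. if i \<in> A then f i else g i) = (\<Prod>i\<in>A. f i) * (\<Prod>i\<in>I - A. g i)"
  using assms by (simp add: prod.If_cases Int_absorb1 Diff_eq)

lemma F_N_eq_F_state:
  assumes "k \<noteq> []"
  shows "F_N N k = (\<Sum>n = 1..N - 1. F_state (of_nat N + tvar) (rev k) False n + F_state (of_nat N + tvar) (rev k) True n)"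
proof -
  define T where "T = of_nat N + tvar"
  define r where "r = length k"
  have "F_N N k = (\<Sum>A\<in>Pow {1..r}. \<Sum>ns | length ns = r \<and> set ns \<subseteq> {1..N - 1}.
      (\<Prod>i\<in>{1..r}. F_weight T (k ! (i - 1)) (i \<in> A) (ns ! (i - 1))) *
      (\<Prod>i\<in>{1..<r}. of_bool (strict_into (i \<in> A) (ns ! (i - 1)) (i + 1 \<in> A) (ns ! i))))"
    unfolding F_N_def Let_def r_def[symmetric] sum_Sbar sum_distrib_left
  proof (intro sum.cong refl)
    fix A ns assume A: "A \<in> Pow {1..r}"
    have "(\<Prod>i\<in>{1..r}. F_weight T (k ! (i - 1)) (i \<in> A) (ns ! (i - 1)))
      = (\<Prod>i\<in>A. - (inverse (of_nat N - of_nat (ns ! (i - 1)) + tvar) ^ (k ! (i - 1)))) *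
        (\<Prod>i\<in>{1..r} - A. inverse (of_nat (ns ! (i - 1))) ^ (k ! (i - 1)))"
      using A by (subst prod_split_subset[symmetric]) (auto simp: F_weight_def T_def algebra_simps intro!: prod.cong)
    also have "\<dots> = (-1) ^ card A * (\<Prod>i\<in>A. inverse (of_nat N - of_nat (ns ! (i - 1)) + tvar) ^ (k ! (i - 1))) *
        (\<Prod>i\<in>{1..r} - A. inverse (of_nat (ns ! (i - 1))) ^ (k ! (i - 1)))"
      by (simp only: prod_uminus)
    finally show "(-1) ^ card A *
       ((\<Prod>i\<in>{1..<r}. of_bool (strict_into (i \<in> A) (ns ! (i - 1)) (i + 1 \<in> A) (ns ! i))) *
        ((\<Prod>i\<in>A. inverse (of_nat N - of_nat (ns ! (i - 1)) + tvar) ^ (k ! (i - 1))) *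
         (\<Prod>i\<in>{1..r} - A. inverse (of_nat (ns ! (i - 1))) ^ (k ! (i - 1))))) =
       (\<Prod>i\<in>{1..r}. F_weight T (k ! (i - 1)) (i \<in> A) (ns ! (i - 1))) *
       (\<Prod>i\<in>{1..<r}. of_bool (strict_into (i \<in> A) (ns ! (i - 1)) (i + 1 \<in> A) (ns ! i)))"
      by (simp only: mult_ac)
  qed
  also have "\<dots> = (\<Sum>A\<in>Pow {1..length (map (F_weight T) k)}. \<Sum>ns | length ns = length (map (F_weight T) k) \<and> set ns \<subseteq> {1..N - 1}.
      (\<Prod>i\<in>{1..length (map (F_weight T) k)}. (map (F_weight T) k ! (i - 1)) (i \<in> A) (ns ! (i - 1))) *
      (\<Prod>i\<in>{1..<length (map (F_weight T) k)}. of_bool (strict_into (i \<in> A) (ns ! (i - 1)) (i + 1 \<in> A) (ns ! i))) *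
      (\<lambda>b n. 1) (length (map (F_weight T) k) \<in> A) (ns ! (length (map (F_weight T) k) - 1)))"
    unfolding length_map r_def[symmetric]
      mult_1_right
    by (intro sum.cong refl arg_cong2[of _ _ _ _ "(*)"] prod.cong) (auto simp: r_def)
  also have "\<dots> = (\<Sum>n = 1..N - 1. F_state T (rev k) False n + F_state T (rev k) True n)"
    using assms by (subst sum_transfer)
      (simp_all add: rev_map transfer_F_state[where M = "N - 1", simplified])
  finally show ?thesis by (simp only: T_def)
qed

lemma G_N_eq_G_state:
  assumes "l \<noteq> []" "0 < N"
  shows "G_N N l = (\<Sum>n = 1..N - 1. G_state (of_nat N + tvar) (rev l) False n * ((-1) ^ (n - 1) * binomT tvar n *
           pochhammer (1 - of_nat N) n / pochhammer (1 - of_nat N - tvar) n))"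
proof -
  define T where "T = of_nat N + tvar"
  define c where "c n = (-1) ^ (n - 1) * binomT tvar n *
           pochhammer (1 - of_nat N) n / pochhammer (1 - of_nat N - tvar) n" for n
  \<comment> \<open>The value 0 encodes that the last position is excluded from A.\<close>
  define h where "h b n = (if b then 0 else c n)" for b n
  define r where "r = length l"
  have r: "1 \<le> r" using assms by (cases l) (auto simp: r_def)
  define g where "g A = (\<Sum>ns | length ns = r \<and> set ns \<subseteq> {1..N - 1}.
      (\<Prod>i\<in>{1..r}. G_weight T (l ! (i - 1)) (i \<in> A) (ns ! (i - 1))) *
      (\<Prod>i\<in>{1..<r}. of_bool (strict_enter (i \<in> A) (ns ! (i - 1)) (i + 1 \<in> A) (ns ! i))) *
      h (r \<in> A) (ns ! (r - 1)))" for A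
  have "G_N N l = (\<Sum>A\<in>Pow ({i\<in>{1..r}. l ! (i - 1) = 1} - {r}). g A)"
    unfolding G_N_def Let_def r_def[symmetric] sum_Sstar g_def
  proof (intro sum.cong refl)
    fix A ns assume A: "A \<in> Pow ({i\<in>{1..r}. l ! (i - 1) = 1} - {r})"
    have "(\<Prod>i\<in>{1..r}. G_weight T (l ! (i - 1)) (i \<in> A) (ns ! (i - 1)))
      = (\<Prod>i\<in>A. inverse (of_nat N - of_nat (ns ! (i - 1)) + tvar)) *
        (\<Prod>i\<in>{1..r} - A. inverse (of_nat (ns ! (i - 1))) ^ (l ! (i - 1)))"
      using A by (subst prod_split_subset[symmetric]) (auto simp: G_weight_def T_def algebra_simps intro!: prod.cong)
    moreover have "h (r \<in> A) (ns ! (r - 1)) = c (ns ! (r - 1))" using A by (auto simp: h_def)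
    ultimately show "(\<Prod>i\<in>{1..<r}. of_bool (strict_enter (i \<in> A) (ns ! (i - 1)) (i + 1 \<in> A) (ns ! i))) *
       ((\<Prod>i\<in>A. inverse (of_nat N - of_nat (ns ! (i - 1)) + tvar)) *
        (\<Prod>i\<in>{1..r} - A. inverse (of_nat (ns ! (i - 1))) ^ (l ! (i - 1))) *
        ((- 1) ^ (ns ! (r - 1) - 1) * binomT tvar (ns ! (r - 1)) * pochhammer (1 - of_nat N) (ns ! (r - 1)) /
         pochhammer (1 - of_nat N - tvar) (ns ! (r - 1)))) =
       (\<Prod>i\<in>{1..r}. G_weight T (l ! (i - 1)) (i \<in> A) (ns ! (i - 1))) *
       (\<Prod>i\<in>{1..<r}. of_bool (strict_enter (i \<in> A) (ns ! (i - 1)) (i + 1 \<in> A) (ns ! i))) *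
       h (r \<in> A) (ns ! (r - 1))"
      by (simp only: c_def[symmetric]) (simp only: mult_ac)
  qed
  \<comment> \<open>Any additional A either contains \<open>r\<close>, where \<open>h\<close>
    vanishes, or a position with entry other than 1, where \<open>G_weight\<close> vanishes.\<close>
  also have "\<dots> = (\<Sum>A\<in>Pow {1..r}. g A)"
  proof (rule sum.mono_neutral_left)
    show "\<forall>A\<in>Pow {1..r} - Pow ({i \<in> {1..r}. l ! (i - 1) = 1} - {r}). g A = 0"
    proof
      fix A assume A: "A \<in> Pow {1..r} - Pow ({i \<in> {1..r}. l ! (i - 1) = 1} - {r})"
      show "g A = 0"
      proof (cases "r \<in> A")
        case False
        with A have "A \<subseteq> {1..r}" "\<not> A \<subseteq> {i. l ! (i - 1) = 1}" by blast+
        then obtain i where "i \<in> A" "i \<in> {1..r}" "l ! (i - 1) \<noteq> 1" by blast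
        then have "(\<Prod>i\<in>{1..r}. G_weight T (l ! (i - 1)) (i \<in> A) (ns ! (i - 1))) = 0" for ns
          by (intro prod_zero) (auto simp: G_weight_def)
        then show ?thesis by (simp only: g_def mult_zero_left sum.neutral_const)
      qed (simp add: g_def h_def)
    qed
  qed auto
  also have "\<dots> = (\<Sum>A\<in>Pow {1..length (map (G_weight T) l)}. \<Sum>ns | length ns = length (map (G_weight T) l) \<and> set ns \<subseteq> {1..N - 1}.
      (\<Prod>i\<in>{1..length (map (G_weight T) l)}. (map (G_weight T) l ! (i - 1)) (i \<in> A) (ns ! (i - 1))) *
      (\<Prod>i\<in>{1..<length (map (G_weight T) l)}. of_bool (strict_enter (i \<in> A) (ns ! (i - 1)) (i + 1 \<in> A) (ns ! i))) *
      h (length (map (G_weight T) l) \<in> A) (ns ! (length (map (G_weight T) l) - 1)))"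
    unfolding length_map r_def[symmetric] g_def
    by (intro sum.cong refl arg_cong2[of _ _ _ _ "(*)"] prod.cong) (auto simp: r_def)
  also have "\<dots> = (\<Sum>n = 1..N - 1. G_state T (rev l) False n * c n)"
    using assms by (subst sum_transfer)
      (simp_all add: h_def rev_map transfer_G_state[where M = "N - 1", simplified])
  finally show ?thesis by (simp only: T_def c_def)
qed

section \<open>Dual indices are linked, and evaluation at level \<open>N - 1\<close>\<close>

lemma (in non_nat_parameter) linked_hoffman_dual:
  assumes "k \<noteq> []" "is_index k"
  shows "linked M (rev k) (rev (hoffman_dual k))"
proof -
  \<comment> \<open>Positivity of the dual entries is carried along because
    \<open>linked_snoc\<close> requires it of the last one.\<close>
  have "linked M (rev k) (rev (hoffman_dual k)) \<and> is_index (hoffman_dual k)"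
    using assms
  proof (induction k rule: index_induct)
    case one
    then show ?case using linked_one hoffman_dual_one by (simp add: is_index_def)
  next
    case (incr ks x)
    obtain ls y where "hoffman_dual (ks @ [x]) = ls @ [y]"
      using hoffman_dual_ne[OF incr(1)] by (metis rev_exhaust)
    then show ?case
      using incr linked_incr[of M x "rev ks" y "rev ls"]
      by (simp add: hoffman_dual_incr[OF incr(1)] is_index_def)
  next
    case (snoc ks x)
    obtain ls y where *: "hoffman_dual (ks @ [x]) = ls @ [y]"
      using hoffman_dual_ne[OF snoc(1)] by (metis rev_exhaust)
    then have "0 < y" using snoc by (auto simp: is_index_def)
    then show ?case
      using * snoc linked_snoc[of M x "rev ks" y "rev ls"]
      by (simp add: is_index_def hoffman_dual_snoc[OF snoc(1), simplified])
  qed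
  then show ?thesis ..
qed

theorem mainTheorem16:
  fixes N :: nat and k :: "nat list"
  assumes "0 < N" and "k \<noteq> []" and "is_index k"
  shows "F_N N k = G_N N (hoffman_dual k)"
proof -
  interpret non_nat_parameter "of_nat N + tvar"
    by unfold_locales (rule tvar_add_of_nat_ne)
  obtain ks x where "k = ks @ [x]" using assms(2) by (metis rev_exhaust)
  then have ne: "hoffman_dual k \<noteq> []" using hoffman_dual_ne assms(3) by blast
  \<comment> \<open>The connector at level \<open>M\<close> belongs to \<open>N = Suc M\<close>,
    hence the level \<open>N - 1\<close>; then \<open>T - N - i = t - i\<close>.\<close>
  have N: "of_nat (Suc (N - 1)) = (of_nat N :: ratfun)" using assms(1) by simp
  have "connector (N - 1) n = (-1) ^ (n - 1) * binomT tvar n * pochhammer (1 - of_nat N) n / pochhammer (1 - of_nat N - tvar) n"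
    if "n \<in> {1..N - 1}" for n
    using that connector_closed_form[of n "N - 1"] unfolding N by (simp add: binomT_def diff_diff_eq)
  then have "G_N N (hoffman_dual k) = (\<Sum>n = 1..N - 1. connector (N - 1) n * G_state (of_nat N + tvar) (rev (hoffman_dual k)) False n)"
    unfolding G_N_eq_G_state[OF ne assms(1)] by (intro sum.cong refl) (simp add: mult.commute)
  also have "\<dots> = F_N N k"
    unfolding F_N_eq_F_state[OF assms(2)] using linked_sum[OF linked_hoffman_dual[OF assms(2,3)] order_refl] by simp
  finally show ?thesis ..
qed

end
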